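(* Let $G=(V,E)$ be a finite connected graph, let $\mathbb{P}$ be the uniform probability measure on the set of spanning trees of $G$, and for $e\in E$ let $X_e$ be the indicator of the event that $e$ belongs to the chosen spanning tree. Let $f:\{0,1\}^E\to\mathbb{R}$ be any function with Lipschitz constant $1$ with respect to Hamming distance, and write $f$ also for the random variable $f((X_e)_{e\in E})$. Then for every real $a\ge 0$, $$\mathbb{P}(f-\mathbb{E}f\ge a)\le \exp\left(-\frac{a^2}{8\,|V|}\right).$$
   Context: A function $f:\{0,1\}^E\to\mathbb{R}$ has Lipschitz constant $1$ if $|f(x)-f(x')|\le 1$ whenever $x,x'$ differ in exactly one coordinate. A spanning tree of $G=(V,E)$ is a subset $E'\subseteq E$ such that $(V,E')$ is connected and acyclic. *)

theory Defs
  imports "HOL-Probability.Probability" "HOL-Library.FuncSet"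
begin

text \<open>
  Edges are abstract objects with a map \<open>ends\<close> to their sets of endpoints, so loops
  (one endpoint) and parallel edges are allowed. Simple graphs are the case \<open>ends = (\<lambda>e. e)\<close>,
  with \<open>E\<close> a set of two-element subsets of \<open>V\<close>.
\<close>

locale finite_graph =
  fixes V :: "'v set" and E :: "'e set" and ends :: "'e \<Rightarrow> 'v set"
  assumes finite_V: "finite V"
    and finite_E: "finite E"
    and ends_subset: "e \<in> E \<Longrightarrow> ends e \<subseteq> V"
    and card_ends: "e \<in> E \<Longrightarrow> card (ends e) = 1 \<or> card (ends e) = 2"

definition adjacency :: "'e set \<Rightarrow> ('e \<Rightarrow> 'v set) \<Rightarrow> ('v \<times> 'v) set" where
  "adjacency F ends = {(u, v). \<exists>e\<in>F. ends e = {u, v}}"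

definition graph_connected :: "'v set \<Rightarrow> 'e set \<Rightarrow> ('e \<Rightarrow> 'v set) \<Rightarrow> bool" where
  "graph_connected V F ends \<longleftrightarrow>
     V \<noteq> {} \<and> (\<forall>u\<in>V. \<forall>v\<in>V. (u, v) \<in> (adjacency F ends)\<^sup>*)"

text \<open>
  A loop is a cycle of length 1 and two parallel edges form a cycle of length 2;
  \<open>distinct es\<close> prevents a single edge traversed back and forth from being a cycle.
\<close>

definition graph_cycle :: "'e set \<Rightarrow> ('e \<Rightarrow> 'v set) \<Rightarrow> 'v list \<Rightarrow> 'e list \<Rightarrow> bool" where
  "graph_cycle F ends vs es \<longleftrightarrow>
     es \<noteq> [] \<and> length vs = length es \<and> distinct vs \<and> distinct es \<and> set es \<subseteq> F \<and>
     (\<forall>i<length es. ends (es ! i) = {vs ! i, vs ! (Suc i mod length es)})"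

definition graph_acyclic :: "'e set \<Rightarrow> ('e \<Rightarrow> 'v set) \<Rightarrow> bool" where
  "graph_acyclic F ends \<longleftrightarrow> (\<nexists>vs es. graph_cycle F ends vs es)"

definition spanning_trees :: "'v set \<Rightarrow> 'e set \<Rightarrow> ('e \<Rightarrow> 'v set) \<Rightarrow> 'e set set" where
  "spanning_trees V E ends =
     {T. T \<subseteq> E \<and> graph_connected V T ends \<and> graph_acyclic T ends}"

definition uniform_spanning_tree :: "'v set \<Rightarrow> 'e set \<Rightarrow> ('e \<Rightarrow> 'v set) \<Rightarrow> 'e set pmf" where
  "uniform_spanning_tree V E ends = pmf_of_set (spanning_trees V E ends)"

definition cube :: "'e set \<Rightarrow> ('e \<Rightarrow> nat) set" where
  "cube E = (E \<rightarrow>\<^sub>E {0, 1})"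

definition edge_indicators :: "'e set \<Rightarrow> 'e set \<Rightarrow> ('e \<Rightarrow> nat)" where
  "edge_indicators E T = (\<lambda>e\<in>E. indicator T e)"

definition hamming_lipschitz_1 :: "'e set \<Rightarrow> (('e \<Rightarrow> nat) \<Rightarrow> real) \<Rightarrow> bool" where
  "hamming_lipschitz_1 E f \<longleftrightarrow>
     (\<forall>x\<in>cube E. \<forall>x'\<in>cube E. card {e\<in>E. x e \<noteq> x' e} = 1 \<longrightarrow> \<bar>f x - f x'\<bar> \<le> 1)"

end

theory Submission imports Defs begin

text \<open>
  Reveal the edges of the random tree one at a time, in uniformly random order. The law given the
  revealed edges is uniform on the trees containing them, and the expectation of \<open>f\<close> under it is a
  martingale with at most \<open>card V - 1\<close> steps. A step is bounded by 2 if the uniform tree conditioned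
  on \<open>e \<in> T\<close> and the one conditioned on \<open>e \<notin> T\<close> can be coupled so as to differ by one exchange.
  Azuma's inequality then gives the constant \<open>2 * 2\<^sup>2 = 8\<close>. Instead of the coupling we use its dual,
  an inequality between averages (\<open>stochastic_domination\<close>), which follows from pairwise negative
  correlation in all minors by the induction of Feder and Mihail. Negative correlation itself is
  Rayleigh monotonicity: the probability that \<open>e\<close> is in the tree is the energy of the averaged
  unit current between the ends of \<open>e\<close>, and deleting another edge does not decrease that energy.
\<close>

section \<open>Negatively correlated set families\<close>

text \<open>Matroid convention: \<open>I\<close> is contracted and \<open>J\<close> is deleted, except that the members keep \<open>I\<close>.\<close>

definition minor :: "'e set set \<Rightarrow> 'e set \<Rightarrow> 'e set \<Rightarrow> 'e set set" where
  "minor B I J = {T \<in> B. I \<subseteq> T \<and> T \<inter> J = {}}"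

lemma minor_split:
  "minor B I J = minor B (insert x I) J \<union> minor B I (insert x J)"
  "minor B (insert x I) J \<inter> minor B I (insert x J) = {}"
  by (auto simp: minor_def)

lemma sum_minor_split:
  fixes u :: "'e set \<Rightarrow> 'a :: comm_monoid_add"
  assumes "finite B"
  shows "sum u (minor B I J) = sum u (minor B (insert x I) J) + sum u (minor B I (insert x J))"
proof -
  have "finite (minor B I' J')" for I' J'
    using assms by (simp add: minor_def)
  then show ?thesis
    unfolding minor_split(1)[of B I J x] by (intro sum.union_disjoint minor_split)
qed

lemma card_minor_split:
  "finite B \<Longrightarrow> card (minor B I J) = card (minor B (insert x I) J) + card (minor B I (insert x J))"
  using sum_minor_split[of B "\<lambda>_. 1::nat"] by simp

text \<open>Inductive step of \<open>stochastic_domination\<close>: index 1 stands for the members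
  containing the splitting element, index 0 for the others. \<open>nc\<close> says that the
  \<open>q\<close> weights favour index 1 at least as much as the \<open>p\<close> weights, and
  \<open>U\<close> that the mean is larger there, so passing from \<open>p\<close> to
  \<open>q\<close> raises the mean. \<open>UW0\<close> and \<open>UW1\<close> then compare the means
  piece by piece.\<close>

lemma mean_mixture_mono:
  fixes p0 p1 q0 q1 U0 U1 W0 W1 :: real
  assumes "p0 > 0" "p1 > 0" "q0 \<ge> 0" "q1 \<ge> 0"
    and nc: "p1 * q0 \<le> p0 * q1"
    and U: "p1 * U0 \<le> p0 * U1"
    and UW0: "q0 * U0 \<le> p0 * W0" and UW1: "q1 * U1 \<le> p1 * W1"
  shows "(q0 + q1) * (U0 + U1) \<le> (p0 + p1) * (W0 + W1)"
proof -
  define m0 m1 where "m0 = U0 / p0" and "m1 = U1 / p1"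
  have eqs: "U0 = p0 * m0" "U1 = p1 * m1"
    using assms by (auto simp: m0_def m1_def)
  have "p1 * (p0 * m0) \<le> p1 * (p0 * m1)"
    using U unfolding eqs by (simp add: mult_ac)
  then have m: "m0 \<le> m1"
    using assms by simp
  have "p0 * (q0 * m0) \<le> p0 * W0" "p1 * (q1 * m1) \<le> p1 * W1"
    using UW0 UW1 unfolding eqs by (simp_all add: mult_ac)
  then have W: "q0 * m0 \<le> W0" "q1 * m1 \<le> W1"
    using assms by simp_all
  \<comment> \<open>This product is the right side minus the left side of the next
    inequality.\<close>
  have "0 \<le> (p0 * q1 - p1 * q0) * (m1 - m0)"
    using nc m by (intro mult_nonneg_nonneg) auto
  then have "(q0 + q1) * (U0 + U1) \<le> (p0 + p1) * (q0 * m0 + q1 * m1)"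
    unfolding eqs by (simp add: algebra_simps)
  also have "\<dots> \<le> (p0 + p1) * (W0 + W1)"
    using W assms by (intro mult_left_mono) auto
  finally show ?thesis .
qed

section \<open>Hoeffding's lemma for weighted finite sums\<close>

lemma cosh_le_exp_square:
  fixes y :: real
  shows "cosh y \<le> exp (y\<^sup>2 / 2)"
proof -
  have "cosh z \<le> exp (z\<^sup>2 / 2)" if z: "z \<ge> 0" for z :: real
  proof -
    \<comment> \<open>The left side is \<open>ln (cosh z)\<close>.\<close>
    have "- (2 * z) * (1/2) + ln (1 + 1/2 * (exp (2 * z) - 1)) \<le> (2 * z)\<^sup>2 / 8"
      using Hoeffdings_lemma_aux[of "2 * z" "1/2"] z by simp
    moreover have pos: "1 + 1/2 * (exp (2 * z) - 1) > 0"
      by (simp add: add_pos_pos field_simps)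
    ultimately have "ln (1 + 1/2 * (exp (2 * z) - 1)) \<le> z + z\<^sup>2 / 2"
      by (simp add: power2_eq_square)
    then have "1 + 1/2 * (exp (2 * z) - 1) \<le> exp (z + z\<^sup>2 / 2)"
      using pos ln_le_cancel_iff[of "1 + 1/2 * (exp (2 * z) - 1)" "exp (z + z\<^sup>2 / 2)"] by simp
    moreover have "1 + 1/2 * (exp (2 * z) - 1) = exp z * cosh z"
      by (simp add: cosh_def algebra_simps flip: exp_add)
    ultimately have "exp z * cosh z \<le> exp z * exp (z\<^sup>2 / 2)"
      by (simp add: exp_add)
    then show ?thesis by simp
  qed
  from this[of "\<bar>y\<bar>"] show ?thesis
    by (cases "y \<ge> 0") auto
qed

text \<open>On [-c, c] convexity puts the exponential below its chord; centring removes the linear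
  part of the chord and leaves a \<open>cosh\<close>. Weights need not sum to 1 because they will be
  cardinalities, and \<open>X\<close> is bounded only where the weight is nonzero because a mean
  over an empty family is a default value.\<close>

lemma weighted_Hoeffding_lemma:
  fixes w X :: "'a \<Rightarrow> real"
  assumes c: "c > 0" and w: "\<And>x. x \<in> A \<Longrightarrow> w x \<ge> 0"
    and X: "\<And>x. x \<in> A \<Longrightarrow> w x \<noteq> 0 \<Longrightarrow> \<bar>X x\<bar> \<le> c"
    and centred: "(\<Sum>x\<in>A. w x * X x) = 0"
  shows "(\<Sum>x\<in>A. w x * exp (l * X x)) \<le> (\<Sum>x\<in>A. w x) * exp ((l * c)\<^sup>2 / 2)"
proof -
  have chord: "exp (l * t) \<le> cosh (l * c) + (t / c) * sinh (l * c)" if "\<bar>t\<bar> \<le> c" for t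
  proof -
    define \<theta> where "\<theta> = (1 + t / c) / 2"
    have \<theta>: "0 \<le> \<theta>" "0 \<le> 1 - \<theta>"
      using that c by (auto simp: \<theta>_def field_simps abs_le_iff)
    have "convex_on UNIV (exp :: real \<Rightarrow> real)"
      using convex_on_exp[of 1] by simp
    from convex_onD[OF this, of "\<theta>" "- (l * c)" "l * c"]
    have "exp ((1 - \<theta>) * (- (l * c)) + \<theta> * (l * c)) \<le> (1 - \<theta>) * exp (- (l * c)) + \<theta> * exp (l * c)"
      using \<theta> by simp
    moreover have "(1 - \<theta>) * (- (l * c)) + \<theta> * (l * c) = l * t"
      using c by (simp add: \<theta>_def field_simps)
    moreover have "(1 - \<theta>) * exp (- (l * c)) + \<theta> * exp (l * c)
        = cosh (l * c) + (t / c) * sinh (l * c)"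
      using c by (simp add: \<theta>_def cosh_def sinh_def field_simps)
    ultimately show ?thesis by simp
  qed
  have "(\<Sum>x\<in>A. w x * exp (l * X x))
      \<le> (\<Sum>x\<in>A. w x * (cosh (l * c) + (X x / c) * sinh (l * c)))"
  proof (rule sum_mono)
    fix x assume "x \<in> A"
    then show "w x * exp (l * X x) \<le> w x * (cosh (l * c) + (X x / c) * sinh (l * c))"
      using chord[of "X x"] X[of x] w[of x] by (cases "w x = 0") (auto intro: mult_left_mono)
  qed
  also have "\<dots> = (\<Sum>x\<in>A. w x * cosh (l * c) + w x * X x * (sinh (l * c) / c))"
    by (simp add: distrib_left mult_ac)
  also have "\<dots> = (\<Sum>x\<in>A. w x) * cosh (l * c) + (\<Sum>x\<in>A. w x * X x) * (sinh (l * c) / c)"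
    by (simp only: sum.distrib flip: sum_distrib_right)
  also have "\<dots> = (\<Sum>x\<in>A. w x) * cosh (l * c)"
    by (simp add: centred)
  also have "\<dots> \<le> (\<Sum>x\<in>A. w x) * exp ((l * c)\<^sup>2 / 2)"
    using w by (intro mult_left_mono cosh_le_exp_square sum_nonneg)
  finally show ?thesis .
qed

text \<open>With denominators cleared, the last assumption is P(e and x) <= P(e) P(x), written
  through the four cells of the joint table so that empty minors need no exception. It is required
  in all minors because the induction passes to minors.\<close>

locale negatively_correlated_family =
  fixes E :: "'e set" and B :: "'e set set" and k :: nat
  assumes finite_ground: "finite E"
    and subset_ground: "T \<in> B \<Longrightarrow> T \<subseteq> E"
    and homogeneous: "T \<in> B \<Longrightarrow> card T = k"
    and negative_correlation: "e \<noteq> x \<Longrightarrow>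
      card (minor B (insert e (insert x I)) J) * card (minor B I (insert e (insert x J)))
      \<le> card (minor B (insert e I) (insert x J)) * card (minor B (insert x I) (insert e J))"
begin

section \<open>Stochastic domination and exponential moments\<close>

lemma finite_family: "finite B"
  using finite_ground subset_ground by (meson Pow_iff finite_Pow_iff finite_subset subsetI)

lemma finite_minor: "finite (minor B I J)"
  using finite_family by (simp add: minor_def)

text \<open>Double counting: each \<open>T\<close> in the minor is counted once for every element of
  \<open>T - I\<close>.\<close>

lemma sum_over_members:
  fixes u :: "'e set \<Rightarrow> real"
  shows "(\<Sum>x\<in>E - I. \<Sum>T\<in>minor B (insert x I) J. u T) = (k - card I) * (\<Sum>T\<in>minor B I J. u T)"
proof -
  have "(\<Sum>x\<in>E - I. \<Sum>T\<in>minor B (insert x I) J. u T)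
      = (\<Sum>x\<in>E - I. \<Sum>T\<in>minor B I J. if x \<in> T then u T else 0)"
  proof (rule sum.cong[OF refl])
    fix x
    have "minor B (insert x I) J = {T \<in> minor B I J. x \<in> T}"
      by (auto simp: minor_def)
    then show "(\<Sum>T\<in>minor B (insert x I) J. u T) = (\<Sum>T\<in>minor B I J. if x \<in> T then u T else 0)"
      using sum.inter_filter[OF finite_minor[of I J], of u "\<lambda>T. x \<in> T"] by simp
  qed
  also have "\<dots> = (\<Sum>T\<in>minor B I J. \<Sum>x\<in>E - I. if x \<in> T then u T else 0)"
    by (rule sum.swap)
  also have "\<dots> = (\<Sum>T\<in>minor B I J. (k - card I) * u T)"
  proof (intro sum.cong refl)
    fix T assume T: "T \<in> minor B I J"
    then have T': "T \<subseteq> E" "card T = k" "I \<subseteq> T"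
      using subset_ground homogeneous by (auto simp: minor_def)
    have "(\<Sum>x\<in>E - I. if x \<in> T then u T else 0) = (\<Sum>x\<in>T - I. u T)"
      using T' finite_ground by (intro sum.mono_neutral_cong_right) auto
    also have "\<dots> = (k - card I) * u T"
      using T' finite_ground by (simp add: card_Diff_subset finite_subset)
    finally show "(\<Sum>x\<in>E - I. if x \<in> T then u T else 0) = (k - card I) * u T" .
  qed
  finally show ?thesis
    by (simp add: sum_distrib_left)
qed

text \<open>Induction on the number of undecided elements. Split both families by an element
  \<open>x\<close> that is nonnegatively correlated with \<open>u\<close> in the first one. The
  induction hypothesis handles both pieces, and by negative correlation the second family contains
  \<open>x\<close> at least as often, which only favours the piece with the larger mean of
  \<open>u\<close>.\<close>

lemma stochastic_domination:
  fixes u w :: "'e set \<Rightarrow> real"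
  assumes "e \<in> E" "e \<notin> I" "e \<notin> J"
    and "\<And>T T'. T \<in> minor B (insert e I) J \<Longrightarrow> T' \<in> minor B I (insert e J) \<Longrightarrow>
           T - {e} \<subseteq> T' \<Longrightarrow> u T \<le> w T'"
  shows "card (minor B I (insert e J)) * (\<Sum>T\<in>minor B (insert e I) J. u T)
       \<le> card (minor B (insert e I) J) * (\<Sum>T\<in>minor B I (insert e J). w T)"
  using assms
proof (induction "card (E - I - J)" arbitrary: I J rule: less_induct)
  case less
  define P Q where "P = minor B (insert e I) J" and "Q = minor B I (insert e J)"
  define P1 P0 where "P1 x = minor B (insert x (insert e I)) J"
    and "P0 x = minor B (insert e I) (insert x J)" for x
  have cardP: "card P = card (P1 x) + card (P0 x)" for x
    unfolding P_def P0_def P1_def using finite_family by (rule card_minor_split)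
  have sumP: "sum u P = sum u (P1 x) + sum u (P0 x)" for x
    unfolding P_def P0_def P1_def using finite_family by (rule sum_minor_split)
  have fin: "finite P" "finite (P1 x)" "finite (P0 x)" for x
    by (auto simp: P_def P0_def P1_def finite_minor)
  consider "P = {}" | "P \<noteq> {}" "\<forall>x\<in>E - I - {e}. P1 x = {} \<or> P0 x = {}"
    | x0 where "x0 \<in> E - I - {e}" "P1 x0 \<noteq> {}" "P0 x0 \<noteq> {}"
    by blast
  then show ?case
  proof cases
    case 1
    then show ?thesis by (simp add: P_def)
  next
    case 2
    then obtain T0 where T0: "T0 \<in> P" by blast
    have unique: "T = T0" if "T \<in> P" for T
    proof -
      have "x \<in> T \<longleftrightarrow> x \<in> T0" if "x \<in> E" for x
      proof (cases "x \<in> insert e I")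
        case True
        then show ?thesis using T0 \<open>T \<in> P\<close> by (auto simp: P_def minor_def)
      next
        case False
        then have "P1 x = {} \<or> P0 x = {}" using 2 that by auto
        then show ?thesis using T0 \<open>T \<in> P\<close> by (auto simp: P_def P0_def P1_def minor_def)
      qed
      then show ?thesis
        using subset_ground T0 \<open>T \<in> P\<close> unfolding P_def minor_def by blast
    qed
    then have P: "P = {T0}" using T0 by blast
    \<comment> \<open>For \<open>x\<close> in \<open>T0 - {e}\<close> outside \<open>I\<close>,
      \<open>P0 x\<close> is empty and \<open>P1 x\<close> is not, so negative correlation leaves no
      member of \<open>Q\<close> that avoids \<open>x\<close>.\<close>
    have covers: "T0 - {e} \<subseteq> T'" if T': "T' \<in> Q" for T'
    proof
      fix x assume x: "x \<in> T0 - {e}"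
      show "x \<in> T'"
      proof (cases "x \<in> I")
        case True
        then show ?thesis using T' by (auto simp: Q_def minor_def)
      next
        case False
        have "x \<in> E" using x T0 subset_ground by (auto simp: P_def minor_def)
        moreover have "T0 \<in> P1 x" using x T0 by (auto simp: P_def P1_def minor_def)
        ultimately have "P1 x \<noteq> {}" "P0 x = {}" using 2 False x by auto
        then have "card (P1 x) > 0" "card (P0 x) = 0"
          using fin by (auto simp: card_gt_0_iff)
        moreover have "card (P1 x) * card (minor B I (insert e (insert x J)))
            \<le> card (P0 x) * card (minor B (insert x I) (insert e J))"
          unfolding P1_def P0_def insert_commute[of x e I]
          using x by (intro negative_correlation) auto
        ultimately have "minor B I (insert e (insert x J)) = {}"
          using finite_minor by simp
        then show ?thesis using T' by (auto simp: Q_def minor_def)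
      qed
    qed
    have "(\<Sum>T\<in>Q. u T0) \<le> (\<Sum>T\<in>Q. w T)"
      using less.prems(4)[of T0] T0 covers by (intro sum_mono) (auto simp: P_def Q_def)
    then show ?thesis
      unfolding P_def[symmetric] Q_def[symmetric] by (simp add: P)
  next
    case (3 x0)
    define nontriv where "nontriv = {x \<in> E - I - {e}. P1 x \<noteq> {} \<and> P0 x \<noteq> {}}"
    \<comment> \<open>Up to the factor \<open>(card P)\<^sup>2\<close>, this is the covariance of
      \<open>u\<close> with the event that \<open>x\<close> belongs to the random member of
      \<open>P\<close>. All members have the same size, so these covariances sum to 0 and one of the
      nontrivial ones is nonnegative.\<close>
    define g where "g x = card P * sum u (P1 x) - card (P1 x) * sum u P" for x
    have "(\<Sum>x\<in>nontriv. g x) = (\<Sum>x\<in>E - insert e I. g x)"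
    proof (rule sum.mono_neutral_left)
      show "\<forall>x\<in>E - insert e I - nontriv. g x = 0"
      proof
        fix x assume "x \<in> E - insert e I - nontriv"
        then have "P1 x = {} \<or> P0 x = {}" by (auto simp: nontriv_def)
        then show "g x = 0"
          using cardP[of x] sumP[of x] by (auto simp: g_def)
      qed
    qed (auto simp: nontriv_def finite_ground)
    also have "\<dots> = card P * (\<Sum>x\<in>E - insert e I. sum u (P1 x))
        - (\<Sum>x\<in>E - insert e I. real (card (P1 x))) * sum u P"
      unfolding g_def sum_subtractf by (simp only: flip: sum_distrib_left sum_distrib_right)
    also have "\<dots> = 0"
      using sum_over_members[of u "insert e I" J] sum_over_members[of "\<lambda>_. 1" "insert e I" J]
      by (simp add: P1_def P_def)
    finally have sum0: "(\<Sum>x\<in>nontriv. g x) = 0" .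
    have "\<exists>x\<in>nontriv. g x \<ge> 0"
    proof (rule ccontr)
      assume "\<not> ?thesis"
      then have "(\<Sum>x\<in>nontriv. g x) < (\<Sum>x\<in>nontriv. 0)"
        using 3 finite_ground by (intro sum_strict_mono) (auto simp: nontriv_def not_le)
      then show False using sum0 by simp
    qed
    then obtain x where x: "x \<in> E" "x \<notin> I" "x \<noteq> e" "P1 x \<noteq> {}" "P0 x \<noteq> {}" and gx: "g x \<ge> 0"
      by (auto simp: nontriv_def)
    have xJ: "x \<notin> J" using x by (auto simp: P1_def minor_def)
    define Q1 Q0 where "Q1 = minor B (insert x I) (insert e J)"
      and "Q0 = minor B I (insert x (insert e J))"
    have cardQ: "card Q = card Q1 + card Q0"
      unfolding Q_def Q1_def Q0_def using finite_family by (rule card_minor_split)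
    have sumQ: "sum w Q = sum w Q1 + sum w Q0"
      unfolding Q_def Q1_def Q0_def using finite_family by (rule sum_minor_split)
    have psubset: "E - insert x I - J \<subset> E - I - J" "E - I - insert x J \<subset> E - I - J"
      using x xJ by auto
    have dec: "card (E - insert x I - J) < card (E - I - J)"
        "card (E - I - insert x J) < card (E - I - J)"
      using psubset finite_ground by (auto intro: psubset_card_mono)
    have IH1: "card Q1 * sum u (P1 x) \<le> card (P1 x) * sum w Q1"
      using less.hyps[OF dec(1)] less.prems x
      by (auto simp: Q1_def P1_def insert_commute minor_def)
    have IH0: "card Q0 * sum u (P0 x) \<le> card (P0 x) * sum w Q0"
      using less.hyps[OF dec(2)] less.prems x
      by (auto simp: Q0_def P0_def insert_commute minor_def)
    have "card (P1 x) * card Q0 \<le> card (P0 x) * card Q1"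
      using negative_correlation[of e x I J] x
      by (simp add: P1_def P0_def Q0_def Q1_def insert_commute)
    then have nc: "real (card (P1 x)) * card Q0 \<le> real (card (P0 x)) * card Q1"
      by (metis of_nat_le_iff of_nat_mult)
    have U: "card (P1 x) * sum u (P0 x) \<le> card (P0 x) * sum u (P1 x)"
      using gx unfolding g_def cardP[of x] sumP[of x] by (simp add: algebra_simps)
    have "(real (card Q0) + card Q1) * (sum u (P0 x) + sum u (P1 x))
        \<le> (real (card (P0 x)) + card (P1 x)) * (sum w Q0 + sum w Q1)"
      using x fin by (intro mean_mixture_mono nc U IH0 IH1) (auto simp: card_gt_0_iff)
    then show ?thesis
      unfolding P_def[symmetric] Q_def[symmetric] cardP[of x] sumP[of x] cardQ sumQ
      by (simp add: add.commute)
  qed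
qed

text \<open>The mean over the whole minor is a mixture of the means over \<open>P\<close> and
  \<open>Q\<close>, so it suffices that these two differ by at most \<open>c\<close>. Members with
  \<open>T - {x}\<close> contained in \<open>T'\<close> have equal size and hence differ by one
  exchange; domination for the pairs \<open>F\<close>, \<open>F + c\<close> and \<open>- F\<close>,
  \<open>c - F\<close> gives the two directions. Everything is multiplied out since \<open>Q\<close>
  may be empty.\<close>

lemma bounded_increment:
  fixes F :: "'e set \<Rightarrow> real"
  assumes lip: "\<And>T T' x y. T \<in> B \<Longrightarrow> T' \<in> B \<Longrightarrow> x \<in> T \<Longrightarrow> y \<notin> T \<Longrightarrow>
      T' = insert y (T - {x}) \<Longrightarrow> \<bar>F T - F T'\<bar> \<le> c"
    and x: "x \<in> E" "x \<notin> I" and ne: "minor B (insert x I) {} \<noteq> {}"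
    and c: "c \<ge> 0"
  shows "\<bar>sum F (minor B (insert x I) {}) / card (minor B (insert x I) {})
          - sum F (minor B I {}) / card (minor B I {})\<bar> \<le> c"
proof -
  define P Q where "P = minor B (insert x I) {}" and "Q = minor B I {x}"
  have swap: "\<bar>F T - F T'\<bar> \<le> c" if T: "T \<in> P" "T' \<in> Q" "T - {x} \<subseteq> T'" for T T'
  proof -
    have B: "T \<in> B" "T' \<in> B" "x \<in> T" "x \<notin> T'"
      using T by (auto simp: P_def Q_def minor_def)
    then have fin: "finite T" "finite T'"
      using subset_ground finite_ground finite_subset by metis+
    have "card (T' - (T - {x})) = card T' - card (T - {x})"
      using fin T by (intro card_Diff_subset) auto
    also have "\<dots> = 1"
      using B homogeneous[of T] homogeneous[of T'] fin card_gt_0_iff[of T] by (auto simp: card_Diff_singleton)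
    finally obtain y where y: "T' - (T - {x}) = {y}"
      by (auto simp: card_1_singleton_iff)
    then have "T' = insert y (T - {x})" "y \<notin> T"
      using T B by auto
    then show ?thesis
      using lip B by blast
  qed
  have "card Q * (\<Sum>T\<in>P. F T) \<le> card P * (\<Sum>T\<in>Q. F T + c)"
    unfolding P_def Q_def
  proof (intro stochastic_domination x)
    fix T T' assume "T \<in> minor B (insert x I) {}" "T' \<in> minor B I {x}" "T - {x} \<subseteq> T'"
    then show "F T \<le> F T' + c" using swap[of T T'] by (simp add: P_def Q_def abs_le_iff)
  qed simp
  then have up: "card Q * sum F P \<le> card P * sum F Q + card P * card Q * c"
    by (simp add: sum.distrib algebra_simps)
  have "card Q * (\<Sum>T\<in>P. - F T) \<le> card P * (\<Sum>T\<in>Q. c - F T)"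
    unfolding P_def Q_def
  proof (intro stochastic_domination x)
    fix T T' assume "T \<in> minor B (insert x I) {}" "T' \<in> minor B I {x}" "T - {x} \<subseteq> T'"
    then show "- F T \<le> c - F T'" using swap[of T T'] by (simp add: P_def Q_def abs_le_iff)
  qed simp
  then have lo: "card P * sum F Q - card P * card Q * c \<le> card Q * sum F P"
    by (simp add: sum_subtractf sum_negf algebra_simps)
  have tot: "card (minor B I {}) = card P + card Q" "sum F (minor B I {}) = sum F P + sum F Q"
    unfolding P_def Q_def by (rule card_minor_split sum_minor_split, rule finite_family)+
  have p: "real (card P) > 0"
    using ne finite_minor by (simp add: P_def card_gt_0_iff)
  have eq: "sum F P / card P - (sum F P + sum F Q) / (real (card P) + card Q)
      = (card Q * sum F P - card P * sum F Q) / (card P * (real (card P) + card Q))"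
    using p by (simp add: field_simps)
  have bound: "\<bar>card Q * sum F P - card P * sum F Q\<bar> \<le> card P * card Q * c"
    using up lo by (auto simp: abs_le_iff)
  also have "\<dots> \<le> c * (card P * (real (card P) + card Q))"
    using c p by (simp add: algebra_simps)
  finally show ?thesis
    unfolding P_def[symmetric] tot of_nat_add eq
    using p by (simp add: abs_divide divide_le_eq)
qed

text \<open>Azuma's argument for the martingale that reveals the members of the random set one at a
  time in uniformly random order, unrolled as an induction on the number of unrevealed members.\<close>

lemma exponential_moment:
  fixes F :: "'e set \<Rightarrow> real"
  assumes lip: "\<And>T T' x y. T \<in> B \<Longrightarrow> T' \<in> B \<Longrightarrow> x \<in> T \<Longrightarrow> y \<notin> T \<Longrightarrow>
      T' = insert y (T - {x}) \<Longrightarrow> \<bar>F T - F T'\<bar> \<le> c"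
    and c: "c > 0" and ne: "minor B I {} \<noteq> {}"
  shows "(\<Sum>T\<in>minor B I {}. exp (l * F T)) \<le> card (minor B I {})
          * exp (l * (sum F (minor B I {}) / card (minor B I {})) + (k - card I) * ((l * c)\<^sup>2 / 2))"
  using ne
proof (induction "k - card I" arbitrary: I)
  case 0
  have "T = I" if "T \<in> minor B I {}" for T
  proof -
    have T: "I \<subseteq> T" "finite T" "card T \<le> card I"
      using that 0 homogeneous subset_ground finite_subset[OF _ finite_ground]
      by (auto simp: minor_def)
    then have "card I = card T" by (simp add: card_mono le_antisym)
    then show ?thesis using T card_subset_eq by blast
  qed
  then have "minor B I {} = {I}"
    using 0 by blast
  then show ?case using 0 by simp
next
  case (Suc d)
  define A where "A = minor B I {}"
  define Ax where "Ax x = minor B (insert x I) {}" for x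
  define m where "m = sum F A / card A"
  \<comment> \<open>The martingale increment on revealing \<open>x\<close>. If \<open>Ax x\<close>
    is empty, the value is \<open>- m\<close>, but its weight \<open>card (Ax x)\<close> is
    0.\<close>
  define X where "X x = sum F (Ax x) / card (Ax x) - m" for x
  have finI: "finite I"
  proof -
    obtain T where "T \<in> B" "I \<subseteq> T" using Suc.prems by (auto simp: minor_def)
    then show ?thesis
      using subset_ground finite_ground by (meson finite_subset)
  qed
  have A: "real (card A) > 0"
    using Suc.prems finite_minor by (simp add: A_def card_gt_0_iff)
  \<comment> \<open>Weighting \<open>x\<close> by \<open>card (Ax x)\<close> amounts to drawing
    \<open>T\<close> uniformly and then a uniform element of \<open>T - I\<close>. The factor
    \<open>Suc d\<close> counts these elements and cancels at the end.\<close>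
  have members: "(\<Sum>x\<in>E - I. sum u (Ax x)) = Suc d * sum u A" for u :: "'e set \<Rightarrow> real"
    using sum_over_members[of u I "{}"] Suc.hyps(2) by (simp add: Ax_def A_def)
  have cards: "(\<Sum>x\<in>E - I. real (card (Ax x))) = real (Suc d) * card A"
    using members[of "\<lambda>_. 1"] by simp
  have sumF: "card (Ax x) * X x = sum F (Ax x) - card (Ax x) * m" for x
    using finite_minor[of "insert x I" "{}"]
    by (cases "Ax x = {}") (auto simp: X_def Ax_def right_diff_distrib card_eq_0_iff)
  have "(\<Sum>x\<in>E - I. card (Ax x) * X x) = Suc d * sum F A - real (Suc d) * card A * m"
    unfolding sumF sum_subtractf members cards[symmetric] by (simp add: sum_distrib_right)
  also have "\<dots> = 0"
    using A by (simp add: m_def)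
  finally have centred: "(\<Sum>x\<in>E - I. card (Ax x) * X x) = 0" .
  have "(\<Sum>T\<in>Ax x. exp (l * F T))
      \<le> exp (l * m + d * ((l * c)\<^sup>2 / 2)) * (card (Ax x) * exp (l * X x))" if x: "x \<in> E - I" for x
  proof (cases "Ax x = {}")
    case False
    have "d = k - card (insert x I)"
      using Suc.hyps(2) finI x by simp
    from Suc.hyps(1)[OF this] False
    have "(\<Sum>T\<in>Ax x. exp (l * F T))
        \<le> card (Ax x) * exp (l * (X x + m) + d * ((l * c)\<^sup>2 / 2))"
      using \<open>d = k - card (insert x I)\<close> by (simp add: Ax_def X_def)
    then show ?thesis
      by (simp add: exp_add distrib_left mult_ac)
  qed simp
  then have "(\<Sum>x\<in>E - I. \<Sum>T\<in>Ax x. exp (l * F T))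
      \<le> (\<Sum>x\<in>E - I. exp (l * m + d * ((l * c)\<^sup>2 / 2)) * (card (Ax x) * exp (l * X x)))"
    by (rule sum_mono)
  also have "\<dots> = exp (l * m + d * ((l * c)\<^sup>2 / 2)) * (\<Sum>x\<in>E - I. card (Ax x) * exp (l * X x))"
    by (simp add: sum_distrib_left)
  also have "\<dots> \<le> exp (l * m + d * ((l * c)\<^sup>2 / 2))
      * ((\<Sum>x\<in>E - I. card (Ax x)) * exp ((l * c)\<^sup>2 / 2))"
  proof -
    have "\<bar>X x\<bar> \<le> c" if "x \<in> E - I" "real (card (Ax x)) \<noteq> 0" for x
      unfolding X_def Ax_def m_def A_def
      using that c by (intro bounded_increment lip) (auto simp: Ax_def)
    then show ?thesis
      using weighted_Hoeffding_lemma[OF c, of "E - I" "\<lambda>x. card (Ax x)" X l] centred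
      by (simp add: mult_left_mono)
  qed
  also have "\<dots> = Suc d * (card A * exp (l * m + Suc d * ((l * c)\<^sup>2 / 2)))"
  proof -
    have step: "exp (l * m + Suc d * s) = exp (l * m + d * s) * exp s" for s :: real
      by (simp add: algebra_simps flip: exp_add)
    then show ?thesis
      unfolding of_nat_sum cards step by (simp only: mult_ac)
  qed
  finally have "Suc d * (\<Sum>T\<in>A. exp (l * F T))
      \<le> Suc d * (card A * exp (l * m + Suc d * ((l * c)\<^sup>2 / 2)))"
    unfolding members .
  then have "(\<Sum>T\<in>A. exp (l * F T)) \<le> card A * exp (l * m + Suc d * ((l * c)\<^sup>2 / 2))"
    by (simp del: of_nat_Suc)
  then show ?case
    using Suc.hyps(2) by (simp add: A_def m_def)
qed

text \<open>Exponential Markov inequality with nothing revealed yet. The positive bound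
  \<open>n\<close> replaces \<open>k\<close> because \<open>k\<close> may be 0, where the quotient
  would divide by 0.\<close>

lemma concentration:
  fixes F :: "'e set \<Rightarrow> real"
  assumes lip: "\<And>T T' x y. T \<in> B \<Longrightarrow> T' \<in> B \<Longrightarrow> x \<in> T \<Longrightarrow> y \<notin> T \<Longrightarrow>
      T' = insert y (T - {x}) \<Longrightarrow> \<bar>F T - F T'\<bar> \<le> c"
    and c: "c > 0" and ne: "B \<noteq> {}" and a: "a \<ge> 0" and n: "k \<le> n" "n > 0"
  shows "measure_pmf.prob (pmf_of_set B) {T. F T - measure_pmf.expectation (pmf_of_set B) F \<ge> a}
         \<le> exp (- (a\<^sup>2 / (2 * c\<^sup>2 * n)))"
proof -
  define m where "m = sum F B / card B"
  define S where "S = B \<inter> {T. F T - m \<ge> a}"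
  \<comment> \<open>The minimiser of \<open>n * ((l * c)\<^sup>2 / 2) - l * a\<close>.\<close>
  define l where "l = a / (c\<^sup>2 * n)"
  have l: "l \<ge> 0" using a by (simp add: l_def)
  have B: "real (card B) > 0"
    using ne finite_family by (simp add: card_gt_0_iff)
  have minor: "minor B {} {} = B"
    by (simp add: minor_def)
  have "card S * exp (l * (m + a)) = (\<Sum>T\<in>S. exp (l * (m + a)))"
    by simp
  also have "\<dots> \<le> (\<Sum>T\<in>S. exp (l * F T))"
    using l by (intro sum_mono) (auto simp: S_def intro!: mult_left_mono)
  also have "\<dots> \<le> (\<Sum>T\<in>B. exp (l * F T))"
    using finite_family by (intro sum_mono2) (auto simp: S_def)
  also have "\<dots> \<le> card B * exp (l * m + k * ((l * c)\<^sup>2 / 2))"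
    using exponential_moment[of F c "{}" l, OF lip c] ne by (simp add: minor m_def)
  also have "\<dots> \<le> card B * exp (l * m + n * ((l * c)\<^sup>2 / 2))"
    using n by (intro mult_left_mono) (auto intro!: mult_right_mono)
  also have "l * m + n * ((l * c)\<^sup>2 / 2) = l * (m + a) + - (a\<^sup>2 / (2 * c\<^sup>2 * n))"
    using n c by (simp add: l_def field_simps power2_eq_square)
  finally have "card S * exp (l * (m + a))
      \<le> (card B * exp (- (a\<^sup>2 / (2 * c\<^sup>2 * n)))) * exp (l * (m + a))"
    by (simp only: exp_add mult_ac)
  then have "card S \<le> card B * exp (- (a\<^sup>2 / (2 * c\<^sup>2 * n)))"
    by simp
  then show ?thesis
    using B ne finite_family
    by (simp add: measure_pmf_of_set integral_pmf_of_set S_def m_def divide_le_eq mult_ac)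
qed

end

section \<open>Spanning trees and electrical flows\<close>

text \<open>An arbitrary orientation makes flows and potential differences signed numbers; a loop
  has \<open>s e = t e\<close>.\<close>

locale oriented_graph =
  fixes V :: "'v set" and E :: "'e set" and ends :: "'e \<Rightarrow> 'v set" and s t :: "'e \<Rightarrow> 'v"
  assumes finite_vertices: "finite V" and nonempty: "V \<noteq> {}" and finite_edges: "finite E"
    and ends_eq: "e \<in> E \<Longrightarrow> ends e = {s e, t e}"
    and s_in: "e \<in> E \<Longrightarrow> s e \<in> V" and t_in: "e \<in> E \<Longrightarrow> t e \<in> V"
begin

section \<open>Connectivity, bridges and cycles\<close>

abbreviation conn :: "'e set \<Rightarrow> 'v \<Rightarrow> 'v \<Rightarrow> bool" where
  "conn F u v \<equiv> (u, v) \<in> (adjacency F ends)\<^sup>*"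

lemma conn_sym: "conn F u v \<Longrightarrow> conn F v u"
proof -
  have "sym (adjacency F ends)"
    by (auto simp: adjacency_def sym_def insert_commute)
  then show "conn F u v \<Longrightarrow> conn F v u"
    by (meson sym_rtrancl symD)
qed

lemma conn_mono: "conn F u v \<Longrightarrow> F \<subseteq> G \<Longrightarrow> conn G u v"
  by (rule subsetD[OF rtrancl_mono]) (auto simp: adjacency_def)

lemma conn_edge: "g \<in> F \<Longrightarrow> g \<in> E \<Longrightarrow> conn F (s g) (t g)"
  using ends_eq by (intro r_into_rtrancl) (auto simp: adjacency_def)

lemma conn_insert:
  assumes "g \<in> E" and "conn (insert g F) u v"
  shows "conn F u v \<or> conn F u (s g) \<and> conn F (t g) v \<or> conn F u (t g) \<and> conn F (s g) v"
  using assms(2)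
proof (induction rule: rtrancl_induct)
  case (step v w)
  then obtain g' where g': "g' = g \<or> g' \<in> F" "ends g' = {v, w}"
    by (auto simp: adjacency_def)
  show ?case
  proof (cases "g' \<in> F")
    case True
    then have "(v, w) \<in> adjacency F ends"
      using g' by (auto simp: adjacency_def)
    then show ?thesis
      using step.IH by (meson rtrancl.rtrancl_into_rtrancl)
  next
    case False
    then have "{v, w} = {s g, t g}"
      using g' ends_eq assms(1) by auto
    then have "v = s g \<and> w = t g \<or> v = t g \<and> w = s g"
      by (auto simp: doubleton_eq_iff)
    then show ?thesis
      using step.IH by auto
  qed
qed auto

lemma conn_potential:
  assumes "conn F u v" and "F \<subseteq> E" and "\<And>g. g \<in> F \<Longrightarrow> h (s g) = h (t g)"
  shows "h u = h v"
  using assms(1)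
proof (induction rule: rtrancl_induct)
  case (step v w)
  then obtain g where "g \<in> F" "ends g = {v, w}"
    by (auto simp: adjacency_def)
  then have "g \<in> F" "v = s g \<and> w = t g \<or> v = t g \<and> w = s g"
    using ends_eq[of g] assms(2) by (auto simp: doubleton_eq_iff)
  then show ?case
    using step.IH assms(3)[of g] by auto
qed simp

text \<open>Acyclicity is encoded as every edge being a bridge, which speaks of \<open>conn\<close>
  alone and suits cuts; \<open>spanning_trees_eq\<close> identifies it with the definition by
  cycles.\<close>

definition is_tree :: "'e set \<Rightarrow> bool" where
  "is_tree T \<longleftrightarrow> T \<subseteq> E \<and> (\<forall>u\<in>V. \<forall>v\<in>V. conn T u v) \<and> (\<forall>g\<in>T. \<not> conn (T - {g}) (s g) (t g))"

lemma conn_tree_minus: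
  assumes "is_tree T" "g \<in> T" "v \<in> V"
  shows "conn (T - {g}) v (s g) \<or> conn (T - {g}) v (t g)"
proof -
  have "g \<in> E" "conn T v (s g)"
    using assms s_in by (auto simp: is_tree_def)
  moreover have "insert g (T - {g}) = T"
    using assms by auto
  ultimately show ?thesis
    using conn_insert[of g v "s g" "T - {g}"] by auto
qed

text \<open>A shortest path between the ends of \<open>g\<close> that avoids \<open>g\<close> is
  closed by \<open>g\<close> to a cycle. Minimality makes its vertices distinct, and then its edges
  are distinct too. A loop gives \<open>n = 0\<close> and a cycle of length 1.\<close>

lemma acyclic_imp_bridge:
  assumes "F \<subseteq> E" "graph_acyclic F ends" "g \<in> F"
  shows "\<not> conn (F - {g}) (s g) (t g)"
proof
  define R where "R = adjacency (F - {g}) ends"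
  assume "conn (F - {g}) (s g) (t g)"
  then obtain n where "(s g, t g) \<in> R ^^ n"
    unfolding R_def by (auto simp: rtrancl_power)
  then obtain n where n: "(s g, t g) \<in> R ^^ n" and least: "\<And>m. (s g, t g) \<in> R ^^ m \<Longrightarrow> n \<le> m"
    using exists_least_iff[of "\<lambda>n. (s g, t g) \<in> R ^^ n"] by (meson not_le)
  from n obtain p where p: "p 0 = s g" "p n = t g" "\<And>i. i < n \<Longrightarrow> (p i, p (Suc i)) \<in> R"
    unfolding relpow_fun_conv by auto
  have walk: "(p i, p j) \<in> R ^^ (j - i)" if "i \<le> j" "j \<le> n" for i j
    unfolding relpow_fun_conv using that p(3) by (intro exI[of _ "\<lambda>l. p (i + l)"]) auto
  have neq: "p i \<noteq> p j" if "i < j" "j \<le> n" for i j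
  proof
    assume "p i = p j"
    then have "(p 0, p n) \<in> R ^^ i O R ^^ (n - j)"
      using walk[of 0 i] walk[of j n] that by auto
    then have "(s g, t g) \<in> R ^^ (i + (n - j))"
      using p by (simp add: relpow_add)
    from least[OF this] that show False by auto
  qed
  then have inj: "inj_on p {..n}"
    by (intro inj_onI) (metis atMost_iff linorder_neqE_nat)
  have "\<exists>e. e \<in> F - {g} \<and> ends e = {p i, p (Suc i)}" if "i < n" for i
    using p(3)[OF that] by (auto simp: R_def adjacency_def)
  then obtain q where q: "\<And>i. i < n \<Longrightarrow> q i \<in> F - {g} \<and> ends (q i) = {p i, p (Suc i)}"
    by metis
  have "inj_on q {..<n}"
  proof (rule inj_onI)
    fix i j assume ij: "i \<in> {..<n}" "j \<in> {..<n}" "q i = q j"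
    then have "{p i, p (Suc i)} = {p j, p (Suc j)}"
      using q by (metis lessThan_iff)
    then have "p i = p j \<or> p i = p (Suc j) \<and> p (Suc i) = p j"
      by (auto simp: doubleton_eq_iff)
    then show "i = j"
      using neq[of i j] neq[of i "Suc j"] neq[of j i] neq[of j "Suc i"] ij
      by (cases i j rule: linorder_cases) auto
  qed
  then have "distinct (map q [0..<n] @ [g])"
    using q by (auto simp: distinct_map atLeast0LessThan)
  moreover have "distinct (map p [0..<Suc n])"
    using inj by (simp add: distinct_map atLeast0LessThan lessThan_Suc_atMost del: upt_Suc)
  moreover have "ends ((map q [0..<n] @ [g]) ! i)
      = {map p [0..<Suc n] ! i, map p [0..<Suc n] ! (Suc i mod Suc n)}" if "i < Suc n" for i
  proof (cases "i < n")
    case True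
    then show ?thesis
      using q[OF True] by (simp add: nth_append del: upt_Suc)
  next
    case False
    then have "i = n" using that by simp
    then show ?thesis
      using p(1,2) ends_eq[of g] subsetD[OF assms(1,3)] by (simp add: nth_append insert_commute del: upt_Suc)
  qed
  ultimately have "graph_cycle F ends (map p [0..<Suc n]) (map q [0..<n] @ [g])"
    unfolding graph_cycle_def using q assms(3) by (auto simp del: upt_Suc)
  then show False
    using assms(2) by (auto simp: graph_acyclic_def)
qed

text \<open>The other edges of a cycle connect the ends of its last edge \<open>g\<close>, and
  \<open>distinct es\<close> keeps \<open>g\<close> out of that path.\<close>

lemma bridges_imp_acyclic:
  assumes "F \<subseteq> E" and bridge: "\<And>g. g \<in> F \<Longrightarrow> \<not> conn (F - {g}) (s g) (t g)"
  shows "graph_acyclic F ends"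
  unfolding graph_acyclic_def
proof clarify
  fix vs es assume cyc: "graph_cycle F ends vs es"
  define n where "n = length es - 1"
  define g where "g = es ! n"
  have len: "length es = Suc n" "length vs = Suc n"
    using cyc by (auto simp: graph_cycle_def n_def)
  have es: "ends (es ! i) = {vs ! i, vs ! (Suc i mod Suc n)}" "es ! i \<in> F" if "i \<le> n" for i
    using cyc len that by (auto simp: graph_cycle_def subset_iff)
  have g: "g \<in> F" "ends g = {vs ! n, vs ! 0}"
    using es[of n] by (auto simp: g_def)
  have "conn (F - {g}) (vs ! 0) (vs ! i)" if "i \<le> n" for i
    using that
  proof (induction i)
    case (Suc i)
    have "es ! i \<noteq> g"
      using cyc len Suc.prems by (auto simp: g_def graph_cycle_def nth_eq_iff_index_eq)
    then have "(vs ! i, vs ! Suc i) \<in> adjacency (F - {g}) ends"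
      using es[of i] Suc.prems by (auto simp: adjacency_def)
    then show ?case
      using Suc by (meson Suc_leD rtrancl.rtrancl_into_rtrancl)
  qed simp
  from this[of n] have "conn (F - {g}) (vs ! 0) (vs ! n)" by simp
  moreover have "{vs ! n, vs ! 0} = {s g, t g}"
    using g ends_eq assms(1) by auto
  ultimately have "conn (F - {g}) (s g) (t g)"
    using conn_sym by (auto simp: doubleton_eq_iff)
  then show False
    using bridge g by blast
qed

lemma spanning_trees_eq: "spanning_trees V E ends = Collect is_tree"
proof -
  have "graph_acyclic T ends \<longleftrightarrow> (\<forall>g\<in>T. \<not> conn (T - {g}) (s g) (t g))" if "T \<subseteq> E" for T
    using that acyclic_imp_bridge[of T] bridges_imp_acyclic[of T] by metis
  then show ?thesis
    using nonempty by (auto simp: spanning_trees_def is_tree_def graph_connected_def)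
qed

text \<open>A connecting edge set of least cardinality works: an edge that is not a bridge could be
  dropped.\<close>

lemma tree_exists:
  assumes "graph_connected V E ends"
  shows "\<exists>T. is_tree T"
proof -
  define P where "P T \<longleftrightarrow> T \<subseteq> E \<and> (\<forall>u\<in>V. \<forall>v\<in>V. conn T u v)" for T
  have "P E" using assms by (auto simp: P_def graph_connected_def)
  then obtain T where T: "P T" "\<And>T'. P T' \<Longrightarrow> card T \<le> card T'"
    using ex_has_least_nat[of P E card] by blast
  have "\<not> conn (T - {g}) (s g) (t g)" if g: "g \<in> T" for g
  proof
    assume c: "conn (T - {g}) (s g) (t g)"
    have "g \<in> E" "insert g (T - {g}) = T"
      using g T by (auto simp: P_def)
    then have "conn (T - {g}) u v" if "conn T u v" for u v
      using conn_insert[of g u v "T - {g}"] that c conn_sym[OF c] by (metis rtrancl_trans)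
    then have "P (T - {g})"
      using T(1) by (auto simp: P_def)
    then have "card T \<le> card (T - {g})"
      by (rule T(2))
    moreover have "finite T"
      using T finite_edges finite_subset by (auto simp: P_def)
    ultimately show False
      using card_Diff1_less[of T g] g by linarith
  qed
  then show ?thesis
    using T by (auto simp: is_tree_def P_def)
qed

section \<open>Components and the number of edges of a tree\<close>

definition component :: "'e set \<Rightarrow> 'v \<Rightarrow> 'v set" where
  "component F v = {u \<in> V. conn F v u}"

lemma component_eq_iff: "v \<in> V \<Longrightarrow> component F u = component F v \<longleftrightarrow> conn F u v"
proof
  assume "v \<in> V" "component F u = component F v"
  then have "v \<in> component F u" by (simp add: component_def)
  then show "conn F u v" by (simp add: component_def)
next
  assume uv: "conn F u v"
  have "conn F u w \<longleftrightarrow> conn F v w" for w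
    using uv conn_sym[OF uv] by (auto intro: rtrancl_trans)
  then show "component F u = component F v" by (simp add: component_def)
qed

lemma card_components_insert:
  assumes "g \<in> E" "\<not> conn F (s g) (t g)"
  shows "Suc (card (component (insert g F) ` V)) = card (component F ` V)"
proof -
  define A B where "A = component F (s g)" and "B = component F (t g)"
  have AB: "A \<in> component F ` V" "B \<in> component F ` V" "A \<noteq> B"
    using assms s_in t_in component_eq_iff by (auto simp: A_def B_def)
  have ins: "conn (insert g F) u v \<longleftrightarrow>
      conn F u v \<or> conn F u (s g) \<and> conn F (t g) v \<or> conn F u (t g) \<and> conn F (s g) v" for u v
    using conn_insert[OF assms(1), of u v F] conn_mono[of _ _ F "insert g F"]
      conn_edge[of g "insert g F"] conn_sym[of "s g" "t g" "insert g F"] assms(1)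
    by (meson insertI1 rtrancl_trans subset_insertI)
  have comp: "component (insert g F) v
      = (if component F v = A \<or> component F v = B then A \<union> B else component F v)" if "v \<in> V" for v
    using that assms(1) s_in t_in component_eq_iff[of "s g" F v] component_eq_iff[of "t g" F v]
    by (auto simp: A_def B_def component_def ins intro: conn_sym rtrancl_trans)
  have "component (insert g F) ` V = insert (A \<union> B) (component F ` V - {A, B})"
    using comp AB by (auto simp: image_iff)
  moreover have "A \<union> B \<notin> component F ` V"
  proof
    assume "A \<union> B \<in> component F ` V"
    then obtain v where "component F v = A \<union> B" by blast
    then have "s g \<in> component F v" "t g \<in> component F v"
      using assms(1) s_in t_in by (auto simp: A_def B_def component_def)
    then show False
      using assms(2) unfolding component_def by (auto intro: conn_sym rtrancl_trans)
  qed
  moreover have "card (component F ` V - {A, B}) = card (component F ` V) - 2"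
      "card (component F ` V) \<ge> 2"
    using AB finite_vertices card_mono[of "component F ` V" "{A, B}"]
    by (auto simp: card_Diff_subset)
  ultimately show ?thesis
    using finite_vertices by simp
qed

text \<open>Insert the edges of \<open>T\<close> one at a time. Each is a bridge of
  \<open>T\<close>, so it merges two components, and the number of components plus edges stays
  \<open>card V\<close>.\<close>

lemma card_tree:
  assumes "is_tree T"
  shows "Suc (card T) = card V"
proof -
  have "finite T" "T \<subseteq> E"
    using assms finite_edges finite_subset by (auto simp: is_tree_def)
  have "card (component F ` V) + card F = card V" if "F \<subseteq> T" for F
    using finite_subset[OF that \<open>finite T\<close>] that
  proof (induction F rule: finite_induct)
    case empty
    have "component {} v = {v}" if "v \<in> V" for v
      using that by (auto simp: component_def adjacency_def)
    then show ?case
      using card_image[of "component {}" V] by (auto simp: inj_on_def)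
  next
    case (insert g F)
    have "\<not> conn F (s g) (t g)"
      using assms insert conn_mono[of "s g" "t g" F "T - {g}"] by (auto simp: is_tree_def)
    then show ?case
      using insert card_components_insert[of g F] \<open>T \<subseteq> E\<close> by auto
  qed
  moreover have "component T ` V = {V}"
    using assms nonempty by (auto simp: is_tree_def component_def)
  ultimately show ?thesis by (metis card_1_singleton_iff order_refl plus_1_eq_Suc One_nat_def)
qed

section \<open>Unit flows along tree paths\<close>

definition side :: "'e set \<Rightarrow> 'v \<Rightarrow> 'v \<Rightarrow> real" where
  "side F v u = (if conn F u v then 1 else 0)"

text \<open>When \<open>F\<close> separates the ends of \<open>e\<close>, this is the sign with
  which \<open>g\<close> crosses from outside the component of \<open>t e\<close> into it. It
  depends on the forest only, so all trees \<open>insert g F\<close> share it.\<close>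

definition cut_weight :: "'e set \<Rightarrow> 'e \<Rightarrow> 'e \<Rightarrow> real" where
  "cut_weight F e g = (if conn F (s e) (t e) then 0 else side F (t e) (t g) - side F (t e) (s g))"

text \<open>The unit flow along the path of \<open>T\<close> from \<open>s e\<close> to
  \<open>t e\<close>: an edge of \<open>T\<close> lies on that path iff deleting it separates the
  ends of \<open>e\<close>.\<close>

definition flow :: "'e set \<Rightarrow> 'e \<Rightarrow> 'e \<Rightarrow> real" where
  "flow T e g = (if g \<in> T then cut_weight (T - {g}) e g else 0)"

lemma side_edge: "g \<in> F \<Longrightarrow> g \<in> E \<Longrightarrow> side F v (s g) = side F v (t g)"
  using conn_edge[of g F] conn_sym[OF conn_edge[of g F]]
  by (auto simp: side_def intro: rtrancl_trans)

text \<open>Telescoping along a walk, with \<open>p\<close> counting signed traversals. One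
  \<open>p\<close> serves all potentials \<open>h\<close>, so it can later be identified by special
  choices of \<open>h\<close>.\<close>

lemma path_coefficients:
  assumes "conn T u v" "T \<subseteq> E"
  shows "\<exists>p :: 'e \<Rightarrow> real. \<forall>h. (\<Sum>g\<in>T. p g * (h (t g) - h (s g))) = h v - h u"
  using assms(1)
proof (induction rule: rtrancl_induct)
  case base
  show ?case by (intro exI[of _ "\<lambda>_. 0"]) simp
next
  case (step v w)
  then obtain p :: "'e \<Rightarrow> real"
    where p: "\<And>h. (\<Sum>g\<in>T. p g * (h (t g) - h (s g))) = h v - h u" by blast
  obtain g where g: "g \<in> T" "ends g = {v, w}"
    using step by (auto simp: adjacency_def)
  then have "v = s g \<and> w = t g \<or> v = t g \<and> w = s g"
    using ends_eq[of g] assms(2) by (auto simp: doubleton_eq_iff)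
  then obtain \<sigma> :: real where \<sigma>: "\<And>h. \<sigma> * (h (t g) - h (s g)) = h w - h v"
    by (metis minus_diff_eq mult_1 mult_minus1)
  have "finite T"
    using assms(2) finite_edges finite_subset by blast
  have "(\<Sum>g'\<in>T. (p g' + (if g' = g then \<sigma> else 0)) * (h (t g') - h (s g'))) = h w - h u" for h
  proof -
    have "(\<Sum>g'\<in>T. (p g' + (if g' = g then \<sigma> else 0)) * (h (t g') - h (s g')))
        = (\<Sum>g'\<in>T. p g' * (h (t g') - h (s g')) + (if g' = g then \<sigma> * (h (t g) - h (s g)) else 0))"
      by (intro sum.cong) (auto simp: algebra_simps)
    also have "\<dots> = h w - h u"
      using g \<open>finite T\<close> by (simp add: sum.distrib p \<sigma>)
    finally show ?thesis .
  qed
  then show ?case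
    by (intro exI[of _ "\<lambda>g'. p g' + (if g' = g then \<sigma> else 0)"] allI)
qed

text \<open>Kirchhoff's node law, tested against potentials. The coefficients of
  \<open>path_coefficients\<close> are the flow: the indicator of the component of
  \<open>t e\<close> in \<open>T - {g}\<close> is constant along every edge of \<open>T\<close> but
  \<open>g\<close>, where it jumps by 1 or -1, and this isolates \<open>p g\<close>.\<close>

lemma unit_flow:
  assumes "is_tree T" "e \<in> E"
  shows "(\<Sum>g\<in>T. flow T e g * (h (t g) - h (s g))) = h (t e) - h (s e)"
proof -
  have T: "T \<subseteq> E" "finite T" "conn T (s e) (t e)"
    using assms finite_edges finite_subset s_in t_in by (auto simp: is_tree_def)
  obtain p :: "'e \<Rightarrow> real"
    where p: "\<And>h. (\<Sum>g\<in>T. p g * (h (t g) - h (s g))) = h (t e) - h (s e)"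
    using path_coefficients[OF T(3,1)] by blast
  have "p g = flow T e g" if g: "g \<in> T" for g
  proof -
    define F where "F = T - {g}"
    let ?h = "side F (t e)"
    have "(\<Sum>g'\<in>T - {g}. p g' * (?h (t g') - ?h (s g'))) = 0"
      using T side_edge by (intro sum.neutral) (auto simp: F_def)
    then have "p g * (?h (t g) - ?h (s g)) = ?h (t e) - ?h (s e)"
      using p[of ?h] T g by (simp add: sum.remove)
    moreover have "?h (t g) - ?h (s g) = 1 \<or> ?h (t g) - ?h (s g) = - 1"
    proof -
      have "\<not> conn F (s g) (t g)"
        using assms(1) g by (auto simp: is_tree_def F_def)
      moreover have "conn F (t e) (s g) \<or> conn F (t e) (t g)"
        using conn_tree_minus[OF assms(1) g] t_in assms(2) by (auto simp: F_def)
      ultimately show ?thesis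
        unfolding side_def by (smt (verit) conn_sym rtrancl_trans)
    qed
    ultimately have "p g = (?h (t e) - ?h (s e)) * (?h (t g) - ?h (s g))"
      by auto
    then show ?thesis
      using g by (auto simp: flow_def cut_weight_def side_def F_def)
  qed
  then have "(\<Sum>g\<in>T. flow T e g * (h (t g) - h (s g))) = (\<Sum>g\<in>T. p g * (h (t g) - h (s g)))"
    by (intro sum.cong) auto
  then show ?thesis
    by (simp add: p)
qed

lemma flow_self: "is_tree T \<Longrightarrow> flow T e e = (if e \<in> T then 1 else 0)"
  by (auto simp: flow_def cut_weight_def side_def is_tree_def)

text \<open>\<open>F\<close> is a tree minus an edge and so has two components; a nonzero weight
  says that \<open>g\<close> joins them, as \<open>g0\<close> did.\<close>

lemma tree_exchange:
  assumes T: "is_tree (insert g0 F)" and g0: "g0 \<notin> F" and e: "e \<in> E" and g: "g \<in> E"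
    and cut_weight: "cut_weight F e g \<noteq> 0"
  shows "g \<notin> F \<and> is_tree (insert g F)"
proof -
  have ncg: "\<not> conn F (s g) (t g)"
    using cut_weight conn_sym rtrancl_trans unfolding cut_weight_def side_def by (smt (verit))
  have F: "F \<subseteq> E" "g0 \<in> E" and F0: "insert g0 F - {g0} = F"
    using T g0 by (auto simp: is_tree_def)
  have "g \<notin> F"
    using ncg conn_edge F by blast
  have sides: "conn F v (s g0) \<or> conn F v (t g0)" if "v \<in> V" for v
    using conn_tree_minus[OF T _ that, of g0] F0 by simp
  have ends: "conn F v (s g) \<or> conn F v (t g)" if "v \<in> V" for v
    using sides[OF that] sides[OF s_in[OF g]] sides[OF t_in[OF g]] ncg
    by (meson conn_sym rtrancl_trans)
  have "conn (insert g F) u v" if "u \<in> V" "v \<in> V" for u v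
  proof -
    have "conn (insert g F) w (s g)" if "w \<in> V" for w
      using ends[OF that] conn_mono[of _ _ F "insert g F"] conn_edge[of g "insert g F"] g
      by (meson conn_sym insertI1 rtrancl_trans subset_insertI)
    then show ?thesis
      using that by (meson conn_sym rtrancl_trans)
  qed
  moreover have "\<not> conn (insert g F - {g'}) (s g') (t g')" if g': "g' \<in> insert g F" for g'
  proof (cases "g' = g")
    case True
    then show ?thesis using ncg \<open>g \<notin> F\<close> by simp
  next
    case False
    define H where "H = F - {g'}"
    have g'F: "g' \<in> F" "g' \<in> E" using False g' F by auto
    have H: "insert g F - {g'} = insert g H" "H \<subseteq> F"
      using False by (auto simp: H_def)
    have "\<not> conn (insert g0 F - {g'}) (s g') (t g')"
      using T g'F by (auto simp: is_tree_def)
    then have nH: "\<not> conn H (s g') (t g')"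
      using conn_mono[of _ _ H "insert g0 F - {g'}"] by (auto simp: H_def)
    show ?thesis
    proof
      \<comment> \<open>The detour would have to use \<open>g\<close>; together with
        \<open>g'\<close>, which lies in \<open>F\<close>, it would connect the ends of
        \<open>g\<close> inside \<open>F\<close>.\<close>
      assume "conn (insert g F - {g'}) (s g') (t g')"
      then have "conn H (s g') (s g) \<and> conn H (t g) (t g') \<or> conn H (s g') (t g) \<and> conn H (s g) (t g')"
        using conn_insert[OF g, of _ _ H] nH H by auto
      then have "conn F (s g') (s g) \<and> conn F (t g) (t g') \<or> conn F (s g') (t g) \<and> conn F (s g) (t g')"
        using conn_mono H by blast
      then show False
        using ncg conn_edge[OF g'F] by (meson conn_sym rtrancl_trans)
    qed
  qed
  ultimately show ?thesis
    using F g \<open>g \<notin> F\<close> unfolding is_tree_def by blast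
qed

section \<open>Averaged flows, their energy and negative correlation\<close>

abbreviation trees :: "'e set set" where
  "trees \<equiv> Collect is_tree"

lemma finite_trees: "finite trees"
  by (rule finite_subset[of _ "Pow E"]) (auto simp: is_tree_def finite_edges)

lemma finite_minor_trees: "finite (minor trees I J)"
  using finite_trees by (simp add: minor_def)

text \<open>Kirchhoff's cycle law for the average of the unit flows along the trees. Grouping the
  pairs of a tree and one of its edges by the two-component forest obtained from deleting the edge,
  every group contributes the net flow of \<open>z\<close> across a cut.\<close>

lemma cycle_law:
  fixes z :: "'e \<Rightarrow> real"
  assumes e: "e \<in> E" and circ: "\<And>h :: 'v \<Rightarrow> real. (\<Sum>g\<in>E. z g * (h (t g) - h (s g))) = 0"
    and zJ: "\<And>g. g \<in> J \<Longrightarrow> z g = 0"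
  shows "(\<Sum>T\<in>minor trees I J. \<Sum>g\<in>E - I. flow T e g * z g) = 0"
proof -
  define M where "M = minor trees I J"
  define X where "X F = {g \<in> E - F - I. insert g F \<in> M}" for F
  have M: "is_tree T" "T \<subseteq> E" "I \<subseteq> T" "T \<inter> J = {}" "finite T" if "T \<in> M" for T
    using that finite_edges finite_subset by (auto simp: M_def minor_def is_tree_def)
  have "(\<Sum>T\<in>M. \<Sum>g\<in>E - I. flow T e g * z g) = (\<Sum>T\<in>M. \<Sum>g\<in>T - I. cut_weight (T - {g}) e g * z g)"
  proof (rule sum.cong[OF refl])
    fix T assume "T \<in> M"
    then show "(\<Sum>g\<in>E - I. flow T e g * z g) = (\<Sum>g\<in>T - I. cut_weight (T - {g}) e g * z g)"
      using M[of T] finite_edges by (intro sum.mono_neutral_cong_right) (auto simp: flow_def)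
  qed
  also have "\<dots> = (\<Sum>(T, g)\<in>(SIGMA T:M. T - I). cut_weight (T - {g}) e g * z g)"
    using M finite_minor_trees by (intro sum.Sigma) (auto simp: M_def)
  also have "\<dots> = (\<Sum>(F, g)\<in>(SIGMA F:Pow E. X F). cut_weight F e g * z g)"
    by (rule sum.reindex_bij_witness[where i = "\<lambda>(F, g). (insert g F, g)"
          and j = "\<lambda>(T, g). (T - {g}, g)"])
      (use M in \<open>auto simp: X_def insert_absorb\<close>)
  also have "\<dots> = (\<Sum>F\<in>Pow E. \<Sum>g\<in>X F. cut_weight F e g * z g)"
    using finite_edges by (intro sum.Sigma[symmetric]) (auto simp: X_def)
  also have "\<dots> = 0"
  proof (rule sum.neutral, rule ballI)
    fix F assume "F \<in> Pow E"
    show "(\<Sum>g\<in>X F. cut_weight F e g * z g) = 0"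
    proof (cases "X F = {} \<or> conn F (s e) (t e)")
      case True
      then show ?thesis by (auto simp: cut_weight_def)
    next
      case False
      then obtain g0 where g0: "g0 \<in> X F" by blast
      have T0: "is_tree (insert g0 F)" "g0 \<notin> F" "I \<subseteq> F" "F \<inter> J = {}"
        using g0 M[of "insert g0 F"] by (auto simp: X_def)
      \<comment> \<open>The added terms vanish: an edge of nonzero weight outside \<open>J\<close>
        completes \<open>F\<close> to a tree of the same minor by \<open>tree_exchange\<close>, and
        \<open>z\<close> is 0 on \<open>J\<close>.\<close>
      have "(\<Sum>g\<in>X F. cut_weight F e g * z g) = (\<Sum>g\<in>E. cut_weight F e g * z g)"
      proof (rule sum.mono_neutral_left)
        show "\<forall>g\<in>E - X F. cut_weight F e g * z g = 0"
        proof
          fix g assume g: "g \<in> E - X F"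
          show "cut_weight F e g * z g = 0"
          proof (rule ccontr)
            assume "cut_weight F e g * z g \<noteq> 0"
            then have "cut_weight F e g \<noteq> 0" "g \<notin> J" using zJ by auto
            moreover from this have "g \<notin> F \<and> is_tree (insert g F)"
              using tree_exchange[OF T0(1,2) e] g by blast
            ultimately have "g \<in> X F"
              using g T0 by (auto simp: X_def M_def minor_def)
            then show False using g by simp
          qed
        qed
      qed (auto simp: X_def finite_edges)
      also have "\<dots> = (\<Sum>g\<in>E. z g * (side F (t e) (t g) - side F (t e) (s g)))"
        using False by (intro sum.cong) (auto simp: cut_weight_def)
      also have "\<dots> = 0" by (rule circ)
      finally show ?thesis .
    qed
  qed
  finally show ?thesis by (simp add: M_def)
qed

text \<open>The flow along \<open>T'\<close> minus the unit flow through \<open>e\<close> itself is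
  a circulation that vanishes on \<open>J\<close>. By \<open>cycle_law\<close> the product with
  \<open>T'\<close> is therefore the total current in \<open>e\<close>, the same for every
  \<open>T'\<close>. The sum leaves out \<open>I\<close> because contracted edges have no
  resistance.\<close>

lemma flow_inner_product:
  assumes e: "e \<in> E" "e \<notin> I" "e \<notin> J" and T': "is_tree T'" "T' \<inter> J = {}"
  shows "(\<Sum>g\<in>E - I. (\<Sum>T\<in>minor trees I J. flow T e g) * flow T' e g)
         = card (minor trees (insert e I) J)"
proof -
  define M where "M = minor trees I J"
  define z where "z g = flow T' e g - (if g = e then 1 else 0)" for g
  have "(\<Sum>g\<in>E. z g * (h (t g) - h (s g))) = 0" for h :: "'v \<Rightarrow> real"
  proof -
    have "(\<Sum>g\<in>E. flow T' e g * (h (t g) - h (s g))) = (\<Sum>g\<in>T'. flow T' e g * (h (t g) - h (s g)))"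
      using T' finite_edges by (intro sum.mono_neutral_right) (auto simp: flow_def is_tree_def)
    moreover have "(\<Sum>g\<in>E. z g * (h (t g) - h (s g))) = (\<Sum>g\<in>E. flow T' e g * (h (t g) - h (s g))
        - (if g = e then h (t e) - h (s e) else 0))"
      by (intro sum.cong) (auto simp: z_def algebra_simps)
    ultimately show ?thesis
      using e finite_edges unit_flow[OF T'(1) e(1), of h] by (simp add: sum_subtractf)
  qed
  moreover have "z g = 0" if "g \<in> J" for g
    using that T' e by (auto simp: z_def flow_def)
  ultimately have "(\<Sum>T\<in>M. \<Sum>g\<in>E - I. flow T e g * z g) = 0"
    unfolding M_def by (rule cycle_law[OF e(1)])
  moreover have "(\<Sum>g\<in>E - I. flow T e g * z g) = (\<Sum>g\<in>E - I. flow T e g * flow T' e g) - flow T e e" for T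
  proof -
    have "(\<Sum>g\<in>E - I. flow T e g * z g)
        = (\<Sum>g\<in>E - I. flow T e g * flow T' e g - (if g = e then flow T e e else 0))"
      by (intro sum.cong) (auto simp: z_def algebra_simps)
    then show ?thesis
      using e finite_edges by (simp add: sum_subtractf)
  qed
  ultimately have "(\<Sum>T\<in>M. \<Sum>g\<in>E - I. flow T e g * flow T' e g) = (\<Sum>T\<in>M. flow T e e)"
    by (simp add: sum_subtractf)
  also have "\<dots> = (\<Sum>T\<in>M. if e \<in> T then 1 else 0)"
    by (intro sum.cong) (auto simp: M_def minor_def flow_self)
  also have "\<dots> = card {T \<in> M. e \<in> T}"
    using finite_minor_trees by (simp add: M_def flip: sum.inter_filter)
  also have "{T \<in> M. e \<in> T} = minor trees (insert e I) J"
    by (auto simp: M_def minor_def)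
  finally show ?thesis
    by (subst (asm) sum.swap) (simp add: M_def sum_distrib_right)
qed

text \<open>Thomson's principle: among the unit flows between the ends of \<open>e\<close>, the average flow
  of the larger graph has the smaller energy, and the energy of an average flow is the probability
  that the tree contains \<open>e\<close>.\<close>

lemma deletion_increases_probability:
  assumes e: "e \<in> E" "e \<notin> I" "e \<notin> J" "e \<noteq> x"
  shows "card (minor trees I (insert x J)) * card (minor trees (insert e I) J)
         \<le> card (minor trees I J) * card (minor trees (insert e I) (insert x J))"
proof -
  define M N where "M = minor trees I J" and "N = minor trees I (insert x J)"
  define Me Ne where "Me = minor trees (insert e I) J" and "Ne = minor trees (insert e I) (insert x J)"
  define \<theta> \<eta> where "\<theta> g = (\<Sum>T\<in>M. flow T e g)" and "\<eta> g = (\<Sum>T\<in>N. flow T e g)" for g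
  define m n where "m = real (card M)" and "n = real (card N)"
  have \<theta>1: "(\<Sum>g\<in>E - I. \<theta> g * flow T e g) = card Me" if "T \<in> M \<union> N" for T
    unfolding \<theta>_def M_def Me_def using that e
    by (intro flow_inner_product) (auto simp: M_def N_def minor_def)
  have \<eta>1: "(\<Sum>g\<in>E - I. \<eta> g * flow T e g) = card Ne" if "T \<in> N" for T
    unfolding \<eta>_def N_def Ne_def using that e
    by (intro flow_inner_product) (auto simp: N_def minor_def)
  have swap: "(\<Sum>g\<in>E - I. \<phi> g * (\<Sum>T\<in>K. flow T e g)) = (\<Sum>T\<in>K. \<Sum>g\<in>E - I. \<phi> g * flow T e g)"
    for \<phi> and K :: "'e set set"
    unfolding sum_distrib_left by (rule sum.swap)
  have \<theta>\<theta>: "(\<Sum>g\<in>E - I. \<theta> g * \<theta> g) = m * card Me"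
    using swap[of \<theta> M] \<theta>1 unfolding \<theta>_def[symmetric] by (simp add: m_def)
  have \<theta>\<eta>: "(\<Sum>g\<in>E - I. \<theta> g * \<eta> g) = n * card Me"
    using swap[of \<theta> N] \<theta>1 unfolding \<eta>_def[symmetric] by (simp add: n_def)
  have \<eta>\<eta>: "(\<Sum>g\<in>E - I. \<eta> g * \<eta> g) = n * card Ne"
    using swap[of \<eta> N] \<eta>1 unfolding \<eta>_def[symmetric] by (simp add: n_def)
  \<comment> \<open>Up to the factor \<open>(m * n)\<^sup>2\<close>, the energy of the difference of
    the average flows. As the cross term reduces to the energy for \<open>M\<close>, it equals the
    energy for \<open>N\<close> minus that for \<open>M\<close>.\<close>
  have "0 \<le> (\<Sum>g\<in>E - I. (n * \<theta> g - m * \<eta> g)\<^sup>2)"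
    by (intro sum_nonneg) auto
  also have "\<dots> = n\<^sup>2 * (\<Sum>g\<in>E - I. \<theta> g * \<theta> g) - 2 * n * m * (\<Sum>g\<in>E - I. \<theta> g * \<eta> g)
      + m\<^sup>2 * (\<Sum>g\<in>E - I. \<eta> g * \<eta> g)"
    by (simp add: sum_distrib_left power2_eq_square algebra_simps flip: sum.distrib sum_subtractf)
  also have "\<dots> = (m * n) * (m * card Ne - n * card Me)"
    unfolding \<theta>\<theta> \<theta>\<eta> \<eta>\<eta> by (simp add: power2_eq_square algebra_simps)
  finally have key: "0 \<le> (m * n) * (m * card Ne - n * card Me)" .
  have "n * card Me \<le> m * card Ne"
  proof (cases "n = 0 \<or> m = 0")
    case True
    \<comment> \<open>Thus \<open>m = 0\<close> forces \<open>n = 0\<close>, and the left side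
      vanishes.\<close>
    have "N \<subseteq> M" by (auto simp: M_def N_def minor_def)
    then have "card N \<le> card M"
      using finite_minor_trees by (simp add: M_def card_mono)
    then show ?thesis using True by (auto simp: m_def n_def)
  next
    case False
    then have "m * n > 0" by (auto simp: m_def n_def)
    then show ?thesis using key by (simp add: zero_le_mult_iff)
  qed
  then have "card N * card Me \<le> card M * card Ne"
    unfolding m_def n_def by (metis of_nat_le_iff of_nat_mult)
  then show ?thesis by (simp add: M_def N_def Me_def Ne_def)
qed

text \<open>With the four cells of the joint table of \<open>e\<close> and \<open>x\<close>,
  \<open>deletion_increases_probability\<close> reads
  \<open>(c + b) * (a + c) \<le> (a + d + (c + b)) * c\<close>, which cancels to
  \<open>a * b \<le> c * d\<close>.\<close>

lemma tree_negative_correlation: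
  assumes "e \<noteq> x"
  shows "card (minor trees (insert e (insert x I)) J) * card (minor trees I (insert e (insert x J)))
    \<le> card (minor trees (insert e I) (insert x J)) * card (minor trees (insert x I) (insert e J))"
proof (cases "e \<in> E \<and> e \<notin> I \<and> e \<notin> J")
  case True
  define a b c d where "a = card (minor trees (insert e (insert x I)) J)"
    and "b = card (minor trees I (insert e (insert x J)))"
    and "c = card (minor trees (insert e I) (insert x J))"
    and "d = card (minor trees (insert x I) (insert e J))"
  have "card (minor trees (insert e I) J) = a + c"
    unfolding a_def c_def insert_commute[of e x] by (rule card_minor_split[OF finite_trees])
  moreover have "card (minor trees I (insert x J)) = c + b"
    unfolding b_def c_def by (rule card_minor_split[OF finite_trees])
  moreover have "card (minor trees I J) = card (minor trees (insert x I) J) + (c + b)"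
    using card_minor_split[OF finite_trees, of I J x] calculation by simp
  moreover have "card (minor trees (insert x I) J) = a + d"
    unfolding a_def d_def by (rule card_minor_split[OF finite_trees])
  ultimately have "(c + b) * (a + c) \<le> (a + d + (c + b)) * c"
    using deletion_increases_probability[of e I J x] True assms by (simp add: c_def)
  then have "a * b \<le> c * d"
    by (simp add: algebra_simps)
  then show ?thesis by (simp add: a_def b_def c_def d_def)
next
  case False
  \<comment> \<open>The first minor is empty if \<open>e\<close> is in \<open>J\<close> or outside
    \<open>E\<close>, the second if \<open>e\<close> is in \<open>I\<close>.\<close>
  then have "minor trees (insert e (insert x I)) J = {} \<or> minor trees I (insert e (insert x J)) = {}"
    by (auto simp: minor_def is_tree_def)
  then show ?thesis by auto
qed

sublocale negatively_correlated_family E trees "card V - 1"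
proof
  show "card T = card V - 1" if "T \<in> trees" for T
    using that card_tree[of T] by simp
  show "T \<subseteq> E" if "T \<in> trees" for T
    using that by (simp add: is_tree_def)
qed (fact finite_edges tree_negative_correlation)+

end

section \<open>Concentration for the uniform spanning tree\<close>

lemma (in finite_graph) oriented_graph_exists:
  assumes "V \<noteq> {}"
  shows "\<exists>s t. oriented_graph V E ends s t"
proof -
  have "\<exists>u v. ends e = {u, v}" if "e \<in> E" for e
    using card_ends[OF that] by (auto simp: card_1_singleton_iff card_2_iff)
  then obtain s t where "\<And>e. e \<in> E \<Longrightarrow> ends e = {s e, t e}"
    by metis
  then have "oriented_graph V E ends s t"
    using ends_subset finite_V finite_E assms by unfold_locales auto
  then show ?thesis by blast
qed

lemma edge_indicators_lipschitz:
  assumes f: "hamming_lipschitz_1 E f" and "T \<subseteq> E" "x \<in> E"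
  shows "\<bar>f (edge_indicators E (insert x T)) - f (edge_indicators E (T - {x}))\<bar> \<le> 1"
proof -
  have "edge_indicators E S \<in> cube E" for S
    by (auto simp: edge_indicators_def cube_def indicator_def)
  moreover have "{e \<in> E. edge_indicators E (insert x T) e \<noteq> edge_indicators E (T - {x}) e} = {x}"
    using assms by (auto simp: edge_indicators_def indicator_def split: if_splits)
  ultimately show ?thesis
    using f unfolding hamming_lipschitz_1_def by (metis card_1_singleton_iff One_nat_def)
qed

theorem theorem1p1:
  fixes V :: "'v set" and E :: "'e set" and ends :: "'e \<Rightarrow> 'v set"
    and f :: "('e \<Rightarrow> nat) \<Rightarrow> real" and a :: real
  assumes "finite_graph V E ends"
    and "graph_connected V E ends"
    and "hamming_lipschitz_1 E f"
    and "a \<ge> 0"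
  shows "measure_pmf.prob (uniform_spanning_tree V E ends)
           {T. f (edge_indicators E T)
                 - measure_pmf.expectation (uniform_spanning_tree V E ends)
                     (\<lambda>T'. f (edge_indicators E T')) \<ge> a}
         \<le> exp (- (a\<^sup>2 / (8 * real (card V))))"
proof -
  have V: "V \<noteq> {}"
    using assms(2) by (simp add: graph_connected_def)
  then obtain s t where "oriented_graph V E ends s t"
    using finite_graph.oriented_graph_exists[OF assms(1)] by blast
  then interpret oriented_graph V E ends s t .
  let ?F = "\<lambda>T. f (edge_indicators E T)"
  \<comment> \<open>An exchange is one removal and one insertion, hence 2; with
    \<open>n = card V\<close> the denominator \<open>2 * c\<^sup>2 * n\<close> becomes
    \<open>8 * card V\<close>.\<close>
  have lip: "\<bar>?F T - ?F T'\<bar> \<le> 2"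
    if T: "T \<in> trees" "T' \<in> trees" "x \<in> T" "y \<notin> T" "T' = insert y (T - {x})" for T T' x y
  proof -
    have "T \<subseteq> E" "x \<in> E" "y \<in> E"
      using T by (auto simp: is_tree_def)
    then have "\<bar>?F (insert x T) - ?F (T - {x})\<bar> \<le> 1"
        "\<bar>?F (insert y (T - {x})) - ?F (T - {x} - {y})\<bar> \<le> 1"
      by (auto intro!: edge_indicators_lipschitz assms(3))
    moreover have "insert x T = T" "T - {x} - {y} = T - {x}"
      using T by auto
    ultimately show ?thesis
      unfolding T(5) by simp
  qed
  have "trees \<noteq> {}"
    using tree_exists[OF assms(2)] by blast
  moreover have "card V > 0"
    using V finite_vertices by (simp add: card_gt_0_iff)
  ultimately show ?thesis
    unfolding uniform_spanning_tree_def spanning_trees_eq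
    using concentration[of ?F 2 a "card V", OF lip _ _ assms(4)] by simp
qed

end
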